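(* For every finite poset $P$ and every positive integer $m$, $$d(P)^m=\sum_{D\in\mathcal{D}(P)} e(m,P-D)=\sum_{U\in\mathcal{U}(P)} e(m,U),$$ and hence $$r(m,P):=d(P)^m-e(m,P)=\sum_{U\in\mathcal{U}(P)\setminus\{K\}} e(m,U),$$ where $K$ is the ground set of $P$.
   Context: For a finite poset $P$ on $K$, $\mathcal{D}(P)$ and $\mathcal{U}(P)$ are its sets of downsets and upsets, $d(P)=|\mathcal{D}(P)|$, $P-D$ is the subposet induced on $K\setminus D$, and $e(m,U)$ means $e(m,P|_U)$ for the induced subposet on $U$. For a finite poset $Q$ on a set $L$ and a finite set $M$ disjoint from $L$ with $|M|=m$, $e(m,Q)$ is the number of partial orders on $M\cup L$ inducing $Q$ on $L$ whose set of minimal elements is exactly $M$ (the empty poset has $e(m,\emptyset)=1$). *)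

theory Defs
  imports Main
begin

text \<open>A poset is a carrier \<open>K\<close> together with a reflexive order relation \<open>r\<close> such that
  \<^term>\<open>partial_order_on K r\<close>, where \<open>(x, y) \<in> r\<close> means \<open>x \<le> y\<close>. The subposet induced on
  \<open>S\<close> is \<^term>\<open>Restr r S\<close>, with carrier \<open>S\<close>.\<close>

definition downsets :: "'a set \<Rightarrow> 'a rel \<Rightarrow> 'a set set" where
  "downsets K r = {D. D \<subseteq> K \<and> (\<forall>x\<in>D. \<forall>y\<in>K. (y, x) \<in> r \<longrightarrow> y \<in> D)}"

definition upsets :: "'a set \<Rightarrow> 'a rel \<Rightarrow> 'a set set" where
  "upsets K r = {U. U \<subseteq> K \<and> (\<forall>x\<in>U. \<forall>y\<in>K. (x, y) \<in> r \<longrightarrow> y \<in> U)}"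

definition num_downsets :: "'a set \<Rightarrow> 'a rel \<Rightarrow> nat" where
  "num_downsets K r = card (downsets K r)"

definition minimal_elements :: "'a set \<Rightarrow> 'a rel \<Rightarrow> 'a set" where
  "minimal_elements A R = {x \<in> A. \<forall>y\<in>A. (y, x) \<in> R \<longrightarrow> y = x}"

definition min_extensions :: "'a set \<Rightarrow> 'a set \<Rightarrow> 'a rel \<Rightarrow> 'a rel set" where
  "min_extensions M L q =
     {R. partial_order_on (M \<union> L) R \<and> Restr R L = q \<and> minimal_elements (M \<union> L) R = M}"

text \<open>The \<open>m\<close>-element set disjoint from \<open>L\<close> is realised as the left summand
  \<open>Inl ` {..<m}\<close> of \<^typ>\<open>nat + 'a\<close>, so that a fresh set exists even when \<open>L\<close> exhausts its type.
  Lemma \<open>num_min_extensions_eq\<close> shows that every other choice gives the same number.\<close>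

definition num_min_extensions :: "nat \<Rightarrow> 'a set \<Rightarrow> 'a rel \<Rightarrow> nat" where
  "num_min_extensions m L q =
     card (min_extensions (Inl ` {..<m} :: (nat + 'a) set) (Inr ` L) (map_prod Inr Inr ` q))"

text \<open>Integer-valued, to avoid truncated subtraction on \<^typ>\<open>nat\<close>.\<close>

definition remainder :: "nat \<Rightarrow> 'a set \<Rightarrow> 'a rel \<Rightarrow> int" where
  "remainder m K r = int (num_downsets K r ^ m) - int (num_min_extensions m K r)"

lemma map_prod_mem_iff:
  assumes "inj_on f A" "R \<subseteq> A \<times> A" "x \<in> A" "y \<in> A"
  shows "(f x, f y) \<in> map_prod f f ` R \<longleftrightarrow> (x, y) \<in> R"
proof
  assume "(f x, f y) \<in> map_prod f f ` R"
  then obtain u v where uv: "(u, v) \<in> R" "f u = f x" "f v = f y" by auto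
  moreover have "u \<in> A" "v \<in> A" using uv(1) assms(2) by auto
  ultimately have "u = x" "v = y" using assms inj_onD by metis+
  then show "(x, y) \<in> R" using uv(1) by simp
qed (rule map_prod_imageI)

lemma min_extensions_image:
  assumes inj: "inj_on f (M \<union> L)" and q: "q \<subseteq> L \<times> L"
    and R: "R \<in> min_extensions M L q"
  shows "map_prod f f ` R \<in> min_extensions (f ` M) (f ` L) (map_prod f f ` q)"
proof -
  let ?A = "M \<union> L"
  define S where "S = map_prod f f ` R"
  have po: "partial_order_on ?A R" and res: "Restr R L = q"
    and mn: "minimal_elements ?A R = M"
    using R by (auto simp: min_extensions_def)
  have sub: "R \<subseteq> ?A \<times> ?A" using po by (simp add: partial_order_onD)
  have iff: "(f x, f y) \<in> S \<longleftrightarrow> (x, y) \<in> R" if "x \<in> ?A" "y \<in> ?A" for x y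
    using map_prod_mem_iff[OF inj sub that] by (simp add: S_def)
  have feq: "f x = f y \<longleftrightarrow> x = y" if "x \<in> ?A" "y \<in> ?A" for x y
    using inj that by (meson inj_on_eq_iff)
  have Rsub: "S \<subseteq> f ` ?A \<times> f ` ?A" using sub by (auto simp: S_def)
  have "partial_order_on (f ` ?A) S"
    unfolding partial_order_on_def preorder_on_def
  proof (intro conjI)
    show "refl_on (f ` ?A) S"
      unfolding refl_on_def using iff partial_order_onD(1)[OF po] by (auto simp: refl_on_def)
    show "trans S"
    proof (rule transI)
      fix a b c assume ab: "(a, b) \<in> S" and bc: "(b, c) \<in> S"
      have "a \<in> f ` ?A" "b \<in> f ` ?A" "c \<in> f ` ?A"
        using subsetD[OF Rsub ab] subsetD[OF Rsub bc] by simp_all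
      then obtain x y z where xyz: "a = f x" "b = f y" "c = f z" "x \<in> ?A" "y \<in> ?A" "z \<in> ?A"
        by (elim imageE)
      then have "(x, y) \<in> R" "(y, z) \<in> R" using ab bc iff by simp_all
      then have "(x, z) \<in> R" by (rule transD[OF partial_order_onD(2)[OF po]])
      then show "(a, c) \<in> S" using xyz iff by simp
    qed
    show "antisym S"
    proof (rule antisymI)
      fix a b assume ab: "(a, b) \<in> S" and ba: "(b, a) \<in> S"
      have "a \<in> f ` ?A" "b \<in> f ` ?A"
        using subsetD[OF Rsub ab] by simp_all
      then obtain x y where xy: "a = f x" "b = f y" "x \<in> ?A" "y \<in> ?A"
        by (elim imageE)
      then have "(x, y) \<in> R" "(y, x) \<in> R" using ab ba iff by simp_all
      then have "x = y" by (rule antisymD[OF partial_order_onD(3)[OF po]])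
      then show "a = b" using xy by simp
    qed
  qed (rule Rsub)
  moreover have "Restr S (f ` L) = map_prod f f ` q"
  proof (intro subset_antisym subsetI)
    fix p assume "p \<in> Restr S (f ` L)"
    then obtain x y where p: "p = (f x, f y)" "x \<in> L" "y \<in> L" "(f x, f y) \<in> S" by blast
    then have "(x, y) \<in> R" using iff by blast
    then have "(x, y) \<in> q" using p res by blast
    then show "p \<in> map_prod f f ` q" unfolding p(1) by (rule map_prod_imageI)
  qed (use q res in \<open>auto simp: S_def\<close>)
  moreover have "minimal_elements (f ` ?A) S = f ` M"
  proof -
    have "f x \<in> minimal_elements (f ` ?A) S \<longleftrightarrow> x \<in> M" if "x \<in> ?A" for x
    proof -
      have "f x \<in> minimal_elements (f ` ?A) S
              \<longleftrightarrow> (\<forall>y\<in>?A. (f y, f x) \<in> S \<longrightarrow> f y = f x)"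
        using that unfolding minimal_elements_def by blast
      also have "\<dots> \<longleftrightarrow> (\<forall>y\<in>?A. (y, x) \<in> R \<longrightarrow> y = x)"
        using iff feq that by (intro ball_cong refl) simp
      also have "\<dots> \<longleftrightarrow> x \<in> minimal_elements ?A R"
        using that unfolding minimal_elements_def by blast
      finally show ?thesis using mn by simp
    qed
    moreover have "minimal_elements (f ` ?A) S \<subseteq> f ` ?A"
      unfolding minimal_elements_def by blast
    ultimately show ?thesis by blast
  qed
  ultimately show ?thesis by (simp add: min_extensions_def image_Un S_def)
qed

lemma map_prod_image_cancel:
  assumes "\<And>x. x \<in> A \<Longrightarrow> g (f x) = x" "R \<subseteq> A \<times> A"
  shows "map_prod g g ` map_prod f f ` R = R"
proof -
  have "(map_prod g g \<circ> map_prod f f) p = p" if "p \<in> R" for p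
    using that assms by auto
  then have "(map_prod g g \<circ> map_prod f f) ` R = (\<lambda>p. p) ` R" by (intro image_cong refl) simp
  then show ?thesis by (simp only: image_comp image_ident)
qed

lemma card_min_extensions_image:
  assumes inj: "inj_on f (M \<union> L)" and q: "q \<subseteq> L \<times> L"
  shows "card (min_extensions (f ` M) (f ` L) (map_prod f f ` q)) = card (min_extensions M L q)"
proof -
  let ?g = "inv_into (M \<union> L) f"
  have gf: "?g (f x) = x" if "x \<in> M \<union> L" for x using inj that by simp
  have fg: "f (?g y) = y" if "y \<in> f ` M \<union> f ` L" for y
    using that by (metis f_inv_into_f image_Un)
  have sub: "R \<subseteq> (M \<union> L) \<times> (M \<union> L)" if "R \<in> min_extensions M L q" for R
    using that by (simp add: min_extensions_def partial_order_onD)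
  have sub': "R \<subseteq> (f ` M \<union> f ` L) \<times> (f ` M \<union> f ` L)"
    if "R \<in> min_extensions (f ` M) (f ` L) (map_prod f f ` q)" for R
    using that by (simp add: min_extensions_def partial_order_onD)
  have gM: "?g ` f ` M = M" "?g ` f ` L = L"
    using gf by (force simp: image_image)+
  have gq: "map_prod ?g ?g ` map_prod f f ` q = q"
    using q gf by (intro map_prod_image_cancel[where A = L]) auto
  have ginj: "inj_on ?g (f ` M \<union> f ` L)" by (metis fg inj_on_inverseI)
  have fq: "map_prod f f ` q \<subseteq> f ` L \<times> f ` L" using q by auto
  have "bij_betw (\<lambda>R. map_prod f f ` R) (min_extensions M L q)
          (min_extensions (f ` M) (f ` L) (map_prod f f ` q))"
  proof (rule bij_betw_byWitness[where f' = "\<lambda>R. map_prod ?g ?g ` R"])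
    show "\<forall>R\<in>min_extensions M L q. map_prod ?g ?g ` map_prod f f ` R = R"
      by (intro ballI map_prod_image_cancel[where A = "M \<union> L"] gf sub)
    show "\<forall>R\<in>min_extensions (f ` M) (f ` L) (map_prod f f ` q).
            map_prod f f ` map_prod ?g ?g ` R = R"
      by (intro ballI map_prod_image_cancel[where A = "f ` M \<union> f ` L"] fg sub')
    show "(\<lambda>R. map_prod f f ` R) ` min_extensions M L q
            \<subseteq> min_extensions (f ` M) (f ` L) (map_prod f f ` q)"
      using min_extensions_image[OF inj q] by blast
    show "(\<lambda>R. map_prod ?g ?g ` R) ` min_extensions (f ` M) (f ` L) (map_prod f f ` q)
            \<subseteq> min_extensions M L q"
      using min_extensions_image[OF ginj fq] unfolding gM gq by blast
  qed
  then show ?thesis by (simp add: bij_betw_same_card)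
qed

lemma num_min_extensions_eq:
  fixes M L :: "'a set"
  assumes "finite M" "card M = m" "M \<inter> L = {}" "q \<subseteq> L \<times> L"
  shows "card (min_extensions M L q) = num_min_extensions m L q"
proof -
  obtain h where h: "bij_betw h M {..<m}"
    using assms by (metis card_lessThan finite_lessThan finite_same_card_bij)
  define f :: "'a \<Rightarrow> nat + 'a" where "f x = (if x \<in> M then Inl (h x) else Inr x)" for x
  have "inj_on f (M \<union> L)"
    using h by (auto simp: inj_on_def f_def bij_betw_def)
  moreover have "f ` M = Inl ` {..<m}"
  proof -
    have "f ` M = Inl ` h ` M" by (auto simp: f_def)
    then show ?thesis using h by (simp add: bij_betw_def)
  qed
  moreover have fL: "f x = Inr x" if "x \<in> L" for x
    using assms(3) that by (auto simp: f_def)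
  then have "f ` L = Inr ` L" by (auto simp: image_iff)
  moreover have "map_prod f f ` q = map_prod Inr Inr ` q"
    using fL assms(4) by (intro image_cong refl) auto
  ultimately show ?thesis
    using card_min_extensions_image[of f M L q] assms(4) by (simp add: num_min_extensions_def)
qed

end

theory Submission
  imports Defs "HOL-Library.FuncSet"
begin

text \<open>A partial order on \<open>M \<union> L\<close> that extends \<open>q\<close> and has \<open>M\<close> as its set of minimal elements is
  determined by the sets \<open>F x\<close> of elements of \<open>L\<close> above the points \<open>x \<in> M\<close>. These sets are
  arbitrary upsets of \<open>L\<close>, subject only to \<open>\<Union>x\<in>M. F x = L\<close>, which says that no element of \<open>L\<close> is
  minimal. Hence \<open>e(m, U)\<close> counts the \<open>m\<close>-tuples of upsets of \<open>P\<close> with union \<open>U\<close>, and the theorem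
  classifies all \<open>m\<close>-tuples of upsets of \<open>P\<close> by their union.\<close>

text \<open>Tuples are extensional functions, so values outside \<open>M\<close> cannot make one
  tuple count several times. Repeated and empty entries are allowed.\<close>

definition upset_covers :: "'b set \<Rightarrow> 'a set \<Rightarrow> 'a rel \<Rightarrow> ('b \<Rightarrow> 'a set) set" where
  "upset_covers M L q = {F \<in> M \<rightarrow>\<^sub>E upsets L q. (\<Union>x\<in>M. F x) = L}"

text \<open>\<open>M\<close> enters as an antichain because distinct minimal elements are
  incomparable. The sum type keeps \<open>M\<close> and \<open>L\<close> disjoint whatever their
  types are.\<close>

definition glue_below :: "'b set \<Rightarrow> 'a rel \<Rightarrow> ('b \<Rightarrow> 'a set) \<Rightarrow> ('b + 'a) rel" where
  "glue_below M q F =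
     (\<lambda>x. (Inl x, Inl x)) ` M \<union> {(Inl x, Inr y) |x y. x \<in> M \<and> y \<in> F x} \<union> map_prod Inr Inr ` q"

lemma glue_below_simps [simp]:
  "(Inl x, Inl x') \<in> glue_below M q F \<longleftrightarrow> x = x' \<and> x \<in> M"
  "(Inl x, Inr y) \<in> glue_below M q F \<longleftrightarrow> x \<in> M \<and> y \<in> F x"
  "(Inr y, Inl x) \<notin> glue_below M q F"
  "(Inr y, Inr y') \<in> glue_below M q F \<longleftrightarrow> (y, y') \<in> q"
  by (auto simp: glue_below_def)

text \<open>Closure of each \<open>F x\<close> upwards is what transitivity needs along
  \<open>Inl\<close>, \<open>Inr\<close>, \<open>Inr\<close>. The covering condition puts some point
  of \<open>M\<close> below every element of \<open>L\<close>, so nothing in \<open>L\<close> stays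
  minimal.\<close>

lemma glue_below_in_min_extensions:
  fixes M :: "'b set" and L :: "'a set"
  assumes q: "partial_order_on L q" and F: "F \<in> upset_covers M L q"
  shows "glue_below M q F \<in> min_extensions (Inl ` M) (Inr ` L) (map_prod Inr Inr ` q)"
proof -
  let ?R = "glue_below M q F" and ?A = "Inl ` M \<union> Inr ` L"
  have qL: "q \<subseteq> L \<times> L" and qrefl: "\<And>y. y \<in> L \<Longrightarrow> (y, y) \<in> q"
    using partial_order_onD[OF q] by (auto simp: refl_on_def)
  have "F x \<in> upsets L q" if "x \<in> M" for x
    using F that by (auto simp: upset_covers_def)
  then have up: "F x \<subseteq> L" "\<And>y z. y \<in> F x \<Longrightarrow> (y, z) \<in> q \<Longrightarrow> z \<in> F x" if "x \<in> M" for x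
    using that qL unfolding upsets_def by blast+
  have cov: "\<exists>x\<in>M. y \<in> F x" if "y \<in> L" for y
    using F that by (auto simp: upset_covers_def)
  have sub: "?R \<subseteq> ?A \<times> ?A"
    using qL up(1) by (force simp: glue_below_def)
  have "partial_order_on ?A ?R"
    unfolding partial_order_on_def preorder_on_def
  proof (intro conjI)
    show "refl_on ?A ?R"
      using qrefl by (auto simp: refl_on_def)
    show "trans ?R"
    proof (rule transI)
      fix a b c assume "(a, b) \<in> ?R" "(b, c) \<in> ?R"
      then show "(a, c) \<in> ?R"
        by (cases a; cases b; cases c)
          (auto intro: up(2) transD[OF partial_order_onD(2)[OF q]])
    qed
    show "antisym ?R"
    proof (rule antisymI)
      fix a b assume "(a, b) \<in> ?R" "(b, a) \<in> ?R"
      then show "a = b"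
        by (cases a; cases b) (auto intro: antisymD[OF partial_order_onD(3)[OF q]])
    qed
  qed (rule sub)
  moreover have "Restr ?R (Inr ` L) = map_prod Inr Inr ` q"
    using qL by (auto simp: glue_below_def)
  moreover have "minimal_elements ?A ?R = Inl ` M"
  proof -
    have "Inr y \<notin> minimal_elements ?A ?R" for y
    proof
      assume y: "Inr y \<in> minimal_elements ?A ?R"
      then have "y \<in> L"
        by (auto simp: minimal_elements_def)
      then obtain x where "x \<in> M" "y \<in> F x"
        using cov by blast
      then have "Inl x \<in> ?A" "(Inl x, Inr y) \<in> ?R"
        by auto
      with y have "(Inl x :: 'b + 'a) = Inr y"
        unfolding minimal_elements_def by blast
      then show False
        by simp
    qed
    moreover have "Inl x \<in> minimal_elements ?A ?R \<longleftrightarrow> x \<in> M" for x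
      by (auto simp: minimal_elements_def)
    ultimately have "a \<in> minimal_elements ?A ?R \<longleftrightarrow> a \<in> Inl ` M" for a
      by (cases a) auto
    then show ?thesis
      by (rule set_eqI)
  qed
  ultimately show ?thesis
    by (simp add: min_extensions_def)
qed

text \<open>The strict part of a finite order is acyclic, hence well-founded, so the elements below
  \<open>y\<close> include a minimal one. By transitivity anything below it is also below
  \<open>y\<close>, so it is minimal in all of \<open>A\<close>.\<close>

lemma exists_minimal_below:
  assumes fin: "finite A" and po: "partial_order_on A R" and "y \<in> A"
  shows "\<exists>x\<in>minimal_elements A R. (x, y) \<in> R"
proof -
  have "trans R" and "antisym R" and "(y, y) \<in> R"
    using partial_order_onD[OF po] \<open>y \<in> A\<close> by (auto simp: refl_on_def)
  define B where "B = {x \<in> A. (x, y) \<in> R}"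
  have "acyclic (R - Id)"
    using \<open>trans R\<close> \<open>antisym R\<close> by (simp add: acyclic_def trans_diff_Id)
  moreover have "finite (R - Id)"
    using partial_order_onD(4)[OF po] fin by (meson finite_Diff finite_SigmaI finite_subset)
  ultimately have "wf (R - Id)"
    by (rule finite_acyclic_wf[rotated])
  moreover have "y \<in> B"
    using \<open>y \<in> A\<close> \<open>(y, y) \<in> R\<close> by (simp add: B_def)
  ultimately obtain x where x: "x \<in> B" "\<And>z. (z, x) \<in> R - Id \<Longrightarrow> z \<notin> B"
    by (metis wfE_min)
  have "z = x" if "z \<in> A" "(z, x) \<in> R" for z
    using x that transD[OF \<open>trans R\<close>, of z x y] by (auto simp: B_def)
  then show ?thesis
    using x(1) by (auto simp: B_def minimal_elements_def)
qed

lemma min_extension_eq_glue_below: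
  assumes "finite M" "finite L" and q: "q \<subseteq> L \<times> L"
    and R: "R \<in> min_extensions (Inl ` M) (Inr ` L) (map_prod Inr Inr ` q)"
  shows "\<exists>F\<in>upset_covers M L q. R = glue_below M q F"
proof -
  let ?A = "Inl ` M \<union> Inr ` L"
  have po: "partial_order_on ?A R" and res: "Restr R (Inr ` L) = map_prod Inr Inr ` q"
    and mn: "minimal_elements ?A R = Inl ` M"
    using R by (auto simp: min_extensions_def)
  have sub: "R \<subseteq> ?A \<times> ?A" and refl: "\<And>a. a \<in> ?A \<Longrightarrow> (a, a) \<in> R"
    using partial_order_onD[OF po] by (auto simp: refl_on_def)
  have min: "a = Inl x" if "x \<in> M" "(a, Inl x) \<in> R" for a x
  proof -
    have "Inl x \<in> minimal_elements ?A R" and "a \<in> ?A"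
      using mn that sub by auto
    then show ?thesis
      using that by (simp add: minimal_elements_def)
  qed
  have rr: "(Inr y, Inr z) \<in> R \<longleftrightarrow> (y, z) \<in> q" for y z
  proof -
    have "(Inr y, Inr z) \<in> R \<longleftrightarrow> (Inr y, Inr z) \<in> Restr R (Inr ` L)"
      using sub by auto
    then show ?thesis
      by (auto simp: res)
  qed
  \<comment> \<open>\<open>F\<close> reads off the elements of \<open>L\<close> above each point of
    \<open>M\<close>; \<open>restrict\<close> makes it extensional.\<close>
  define F where "F = restrict (\<lambda>x. {y. (Inl x, Inr y) \<in> R}) M"
  have "F x \<in> upsets L q" if "x \<in> M" for x
    using that sub
    by (auto simp: F_def upsets_def rr[symmetric] intro: transD[OF partial_order_onD(2)[OF po]])
  moreover have "(\<Union>x\<in>M. F x) = L"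
  proof
    show "L \<subseteq> (\<Union>x\<in>M. F x)"
    proof
      fix y assume "y \<in> L"
      \<comment> \<open>Finiteness gives a minimal element below \<open>y\<close>, and all minimal
        elements lie in \<open>M\<close>; this is the covering condition.\<close>
      then obtain a where "a \<in> Inl ` M" "(a, Inr y) \<in> R"
        using exists_minimal_below[OF _ po, of "Inr y"] assms(1,2) mn by auto
      then show "y \<in> (\<Union>x\<in>M. F x)"
        by (auto simp: F_def)
    qed
  qed (use sub in \<open>auto simp: F_def\<close>)
  moreover have "F \<in> extensional M"
    by (simp add: F_def)
  ultimately have "F \<in> upset_covers M L q"
    by (auto simp: upset_covers_def PiE_iff)
  \<comment> \<open>Minimality of \<open>M\<close> leaves only reflexive pairs ending in
    \<open>M\<close>. The pairs from \<open>M\<close> to \<open>L\<close> are those recorded by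
    \<open>F\<close>, and those inside \<open>L\<close> are given by \<open>q\<close>.\<close>
  moreover have "(a, b) \<in> R \<longleftrightarrow> (a, b) \<in> glue_below M q F" for a b
  proof (cases a; cases b)
    fix x x' assume "a = Inl x" "b = Inl x'"
    then show ?thesis
      using min[of x' a] refl sub by auto
  next
    fix x y assume "a = Inl x" "b = Inr y"
    then show ?thesis
      using sub by (auto simp: F_def)
  next
    fix y x assume "a = Inr y" "b = Inl x"
    then show ?thesis
      using min[of x a] sub by auto
  next
    fix y z assume "a = Inr y" "b = Inr z"
    then show ?thesis
      using rr by simp
  qed
  ultimately show ?thesis
    by (intro bexI[of _ F]) auto
qed

lemma card_min_extensions_eq_card_upset_covers:
  assumes "finite M" "finite L" "partial_order_on L q"
  shows "card (min_extensions (Inl ` M) (Inr ` L) (map_prod Inr Inr ` q))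
    = card (upset_covers M L q)"
proof -
  have "inj_on (glue_below M q) (upset_covers M L q)"
  proof (rule inj_onI)
    fix F G assume "F \<in> upset_covers M L q" "G \<in> upset_covers M L q"
      and eq: "glue_below M q F = glue_below M q G"
    then have "F \<in> extensional M" "G \<in> extensional M"
      by (auto simp: upset_covers_def PiE_def)
    \<comment> \<open>Each entry is recovered from the glued order as the set of \<open>y\<close>
      with \<open>Inr y\<close> above \<open>Inl x\<close>.\<close>
    moreover have "F x = G x" if "x \<in> M" for x
      using that glue_below_simps(2)[of x _ M q F] glue_below_simps(2)[of x _ M q G] eq by auto
    ultimately show "F = G"
      by (rule extensionalityI)
  qed
  moreover have "glue_below M q ` upset_covers M L q
      = min_extensions (Inl ` M) (Inr ` L) (map_prod Inr Inr ` q)"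
    using glue_below_in_min_extensions[OF assms(3)]
      min_extension_eq_glue_below[OF assms(1,2) partial_order_onD(4)[OF assms(3)]]
    by blast
  ultimately show ?thesis
    by (metis card_image)
qed

lemma finite_upsets: "finite K \<Longrightarrow> finite (upsets K r)"
  by (rule finite_subset[of _ "Pow K"]) (auto simp: upsets_def)

lemma Union_upsets:
  "(\<And>x. x \<in> M \<Longrightarrow> F x \<in> upsets K r) \<Longrightarrow> (\<Union>x\<in>M. F x) \<in> upsets K r"
  unfolding upsets_def by blast

text \<open>An element of \<open>K\<close> above a member of \<open>V\<close> \<subseteq>
  \<open>U\<close> already lies in \<open>U\<close>, so being closed upwards in \<open>U\<close> and
  in \<open>K\<close> agree.\<close>

lemma upsets_Restr:
  "U \<in> upsets K r \<Longrightarrow> upsets U (Restr r U) = {V \<in> upsets K r. V \<subseteq> U}"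
  unfolding upsets_def by blast

text \<open>Union \<open>U\<close> forces every entry into \<open>U\<close>. The covers of
  \<open>U\<close> thus form the fibre over \<open>U\<close> of the union map on tuples of upsets of
  \<open>K\<close>.\<close>

lemma upset_covers_Restr:
  assumes "U \<in> upsets K r"
  shows "upset_covers M U (Restr r U) = {F \<in> M \<rightarrow>\<^sub>E upsets K r. (\<Union>x\<in>M. F x) = U}"
  using assms by (auto simp: upset_covers_def upsets_Restr PiE_iff)

lemma card_upsets_power:
  assumes "finite K" "finite M"
  shows "card (upsets K r) ^ card M = (\<Sum>U\<in>upsets K r. card (upset_covers M U (Restr r U)))"
proof -
  let ?T = "M \<rightarrow>\<^sub>E upsets K r"
  have "card (upsets K r) ^ card M = card ?T"
    using assms by (simp add: card_PiE)
  also have "\<dots> = (\<Sum>U\<in>upsets K r. card {F \<in> ?T. (\<Union>x\<in>M. F x) = U})"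
  proof -
    have "finite ?T"
      using assms by (simp add: finite_PiE finite_upsets)
    moreover have "(\<lambda>F. \<Union>x\<in>M. F x) ` ?T \<subseteq> upsets K r"
      by (auto intro!: Union_upsets)
    ultimately show ?thesis
      \<comment> \<open>Summing the constant 1 over the fibres of the union map counts all
        tuples.\<close>
      using sum.group[OF _ finite_upsets[OF assms(1)], of ?T "\<lambda>F. \<Union>x\<in>M. F x" r "\<lambda>_. 1 :: nat"]
      by simp
  qed
  also have "\<dots> = (\<Sum>U\<in>upsets K r. card (upset_covers M U (Restr r U)))"
    by (simp add: upset_covers_Restr)
  finally show ?thesis .
qed

text \<open>Complementation is an involution on subsets of \<open>K\<close>, and contraposition
  exchanges the two closure conditions. It serves both to replace \<open>d(P)\<close> by the number
  of upsets and to reindex the sum over downsets.\<close>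

lemma bij_betw_downsets_upsets: "bij_betw (\<lambda>D. K - D) (downsets K r) (upsets K r)"
  by (rule bij_betw_byWitness[where f' = "\<lambda>U. K - U"]) (auto simp: downsets_def upsets_def)

lemma partial_order_on_Restr:
  assumes "partial_order_on K r" "U \<subseteq> K"
  shows "partial_order_on U (Restr r U)"
  using partial_order_onD[OF assms(1)] assms(2)
  by (auto simp: partial_order_on_def preorder_on_def refl_on_def
      intro: trans_Restr antisym_subset)

lemma num_downsets_power:
  assumes "finite K" "partial_order_on K r"
  shows "num_downsets K r ^ m = (\<Sum>U\<in>upsets K r. num_min_extensions m U (Restr r U))"
proof -
  have "num_min_extensions m U (Restr r U) = card (upset_covers {..<m} U (Restr r U))"
    if "U \<in> upsets K r" for U
  proof -
    have "U \<subseteq> K"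
      using that by (simp add: upsets_def)
    then show ?thesis
      unfolding num_min_extensions_def
      by (intro card_min_extensions_eq_card_upset_covers partial_order_on_Restr[OF assms(2)]
          finite_subset[OF _ assms(1)] finite_lessThan)
  qed
  then show ?thesis
    using card_upsets_power[OF assms(1), of "{..<m}" r]
      bij_betw_same_card[OF bij_betw_downsets_upsets, of K r]
    by (simp add: num_downsets_def)
qed

theorem theorem5p1:
  fixes K :: "'a set" and r :: "'a rel" and m :: nat
  assumes "finite K" and "partial_order_on K r" and "m > 0"
  shows "num_downsets K r ^ m = (\<Sum>D\<in>downsets K r. num_min_extensions m (K - D) (Restr r (K - D)))
    \<and> (\<Sum>D\<in>downsets K r. num_min_extensions m (K - D) (Restr r (K - D)))
        = (\<Sum>U\<in>upsets K r. num_min_extensions m U (Restr r U))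
    \<and> remainder m K r
        = (\<Sum>U\<in>upsets K r - {K}. int (num_min_extensions m U (Restr r U)))"
proof -
  let ?e = "\<lambda>U. num_min_extensions m U (Restr r U)"
  have power: "num_downsets K r ^ m = (\<Sum>U\<in>upsets K r. ?e U)"
    using assms(1,2) by (rule num_downsets_power)
  have compl: "(\<Sum>D\<in>downsets K r. ?e (K - D)) = (\<Sum>U\<in>upsets K r. ?e U)"
    by (rule sum.reindex_bij_betw[OF bij_betw_downsets_upsets])
  have "K \<in> upsets K r"
    by (simp add: upsets_def)
  then have "(\<Sum>U\<in>upsets K r. ?e U) = ?e K + (\<Sum>U\<in>upsets K r - {K}. ?e U)"
    using finite_upsets[OF assms(1)] by (simp add: sum.remove)
  \<comment> \<open>This identifies the term split off at \<open>U = K\<close> with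
    \<open>e(m, P)\<close> itself.\<close>
  moreover have "Restr r K = r"
    using partial_order_onD(4)[OF assms(2)] by blast
  ultimately have "remainder m K r = (\<Sum>U\<in>upsets K r - {K}. int (?e U))"
    by (simp add: remainder_def power)
  with power compl show ?thesis
    by simp
qed

end
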